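(* Let $L$ be a completely distributive lattice that is a unital quantale with operation $*$. Let $D$ and $D'$ be complete continuous semilattices, let $\phi:D\to\underline{M}_{[L]}D'$ be an isotone mapping, and let $*:L\times L\to L$ be infinitely distributive also with respect to infimum in both variables. Then $\underline{sp}(\phi):\underline{M}_{[L]}D\to\underline{M}_{[L]}D'$ is lower continuous if and only if $\phi$ is lower continuous, and in this case, for all $m\in\underline{M}_{[L]}D$, $$\underline{sp}(\phi)(m)(b)=\sup\{m(a)*\phi(a)(b)\mid a\in D\},\quad b\in D'.$$
   Context: A domain is a directed complete poset $D$ that is continuous: for each $b\in D$ the set $\{a\in D\mid a\ll b\}$ is directed with supremum $b$, where $a\ll b$ means that for each directed $C\subset D$ with $b\le \sup C$ there is $c\in C$ with $a\le c$. A continuous semilattice is a domain in which every two elements have a meet; it is complete if every nonempty subset has an infimum (a top element is not required). Semilattices are nonempty. The lower topology on a poset $X$ is the least topology in which all sets $\{a\in X\mid b\le a\}$, $b\in X$, are closed. A mapping between posets is lower continuous if it is continuous with respect to the lower topologies on its domain and codomain. $L$ has bottom $0$ and top $1$. That $L$ is a unital quantale means: $*:L\times L\to L$ is an associative binary operation (not necessarily commutative), $1$ is a two-sided unit for $*$, and $*$ distributes over arbitrary suprema in each variable. Infinite distributivity with respect to infimum in both variables means $\alpha*\inf S=\inf\{\alpha*s\mid s\in S\}$ and $(\inf S)*\alpha=\inf\{s*\alpha\mid s\in S\}$ for all $\alpha\in L$ and all nonempty $S\subset L$. $\underline{M}_{[L]}D=[D\to L^{op}]^{op}$ is the set of $L$-fuzzy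 monotonic predicates on $D$: all functions $m:D\to L$ such that $m:D\to L^{op}$ is Scott continuous, i.e. $m$ is antitone and $m(\sup C)=\inf\{m(c)\mid c\in C\}$ in $L$ for each directed $C\subset D$. It is ordered pointwise as functions to $L$ and is a complete lattice. For a mapping $\phi:D\to\underline{M}_{[L]}D'$ and $m\in\underline{M}_{[L]}D$, the strongest postcondition $\underline{sp}(\phi)(m)$ is the least $m'\in\underline{M}_{[L]}D'$ such that $m'(b)\ge m(a)*\phi(a)(b)$ for all $a\in D$, $b\in D'$; explicitly, $$\underline{sp}(\phi)(m)(b)=\inf\bigl\{\sup\{m(a)*\phi(a)(b')\mid a\in D\}\bigm| b'\in D',\ b'\ll b\bigr\},\quad b\in D'.$$ *)

theory Defs
  imports "HOL-Analysis.Analysis"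
begin

context order
begin

definition directed :: "'a set \<Rightarrow> bool"
  where "directed C \<longleftrightarrow> C \<noteq> {} \<and> (\<forall>x\<in>C. \<forall>y\<in>C. \<exists>z\<in>C. x \<le> z \<and> y \<le> z)"

definition is_lub :: "'a set \<Rightarrow> 'a \<Rightarrow> bool"
  where "is_lub C s \<longleftrightarrow> (\<forall>c\<in>C. c \<le> s) \<and> (\<forall>u. (\<forall>c\<in>C. c \<le> u) \<longrightarrow> s \<le> u)"

definition is_glb :: "'a set \<Rightarrow> 'a \<Rightarrow> bool"
  where "is_glb C i \<longleftrightarrow> (\<forall>c\<in>C. i \<le> c) \<and> (\<forall>u. (\<forall>c\<in>C. u \<le> c) \<longrightarrow> u \<le> i)"

definition way_below :: "'a \<Rightarrow> 'a \<Rightarrow> bool"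
  where "way_below a b \<longleftrightarrow>
    (\<forall>C s. directed C \<and> is_lub C s \<and> b \<le> s \<longrightarrow> (\<exists>c\<in>C. a \<le> c))"

end

class dcpo = order +
  assumes directed_has_lub: "directed C \<Longrightarrow> \<exists>s. is_lub C s"

class continuous_domain = dcpo +
  assumes directed_way_below: "directed {a. way_below a b}"
    and is_lub_way_below: "is_lub {a. way_below a b} b"

class continuous_semilattice = continuous_domain + semilattice_inf

class complete_continuous_semilattice = continuous_semilattice +
  assumes nonempty_has_glb: "S \<noteq> {} \<Longrightarrow> \<exists>i. is_glb S i"

text \<open>
  The carrier is an argument because the lower topology is needed both on a whole type and on
  a set of functions. The full carrier is added to the subbase so that the space of the
  generated topology is \<open>X\<close> (an upper bound of \<open>X\<close> lies in no other subbasic set).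
\<close>
definition lower_topology :: "'a::order set \<Rightarrow> 'a topology"
  where "lower_topology X = topology_generated_by (insert X {X - {a \<in> X. b \<le> a} | b. b \<in> X})"

definition lower_continuous :: "'a::order set \<Rightarrow> 'b::order set \<Rightarrow> ('a \<Rightarrow> 'b) \<Rightarrow> bool"
  where "lower_continuous X Y f \<longleftrightarrow> continuous_map (lower_topology X) (lower_topology Y) f"

locale unital_quantale = monoid star top
  for star :: "'l::complete_lattice \<Rightarrow> 'l \<Rightarrow> 'l" +
  assumes star_Sup: "star x (Sup S) = (SUP s\<in>S. star x s)"
    and Sup_star: "star (Sup S) x = (SUP s\<in>S. star s x)"

definition inf_distributive :: "('l::complete_lattice \<Rightarrow> 'l \<Rightarrow> 'l) \<Rightarrow> bool"
  where "inf_distributive star \<longleftrightarrow>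
    (\<forall>x S. S \<noteq> {} \<longrightarrow> star x (Inf S) = (INF s\<in>S. star x s) \<and> star (Inf S) x = (INF s\<in>S. star s x))"

text \<open>
  Scott continuity into the order dual of the lattice, expressed in the lattice itself: directed
  suprema become infima. The set is ordered pointwise, which is the library order on functions.
\<close>
definition fuzzy_predicates :: "('d::order \<Rightarrow> 'l::complete_lattice) set"
  where "fuzzy_predicates =
    {m. antimono m \<and> (\<forall>C s. directed C \<and> is_lub C s \<longrightarrow> m s = (INF c\<in>C. m c))}"

definition strongest_post ::
    "('l::complete_lattice \<Rightarrow> 'l \<Rightarrow> 'l) \<Rightarrow> ('d::order \<Rightarrow> 'e::order \<Rightarrow> 'l) \<Rightarrow> ('d \<Rightarrow> 'l) \<Rightarrow> 'e \<Rightarrow> 'l"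
  where "strongest_post star \<phi> m =
    (LEAST m'. m' \<in> fuzzy_predicates \<and> (\<forall>a b. star (m a) (\<phi> a b) \<le> m' b))"

lemma way_below_imp_le:
  fixes a b :: "'a::order"
  assumes "way_below a b" shows "a \<le> b"
proof -
  have "directed {b}" "is_lub {b} b" by (auto simp: directed_def is_lub_def)
  with assms show ?thesis unfolding way_below_def by blast
qed

lemma way_below_le_trans: "way_below a b \<Longrightarrow> b \<le> c \<Longrightarrow> way_below a (c::'a::order)"
  unfolding way_below_def by (meson order_trans)

lemma le_way_below_trans: "a \<le> b \<Longrightarrow> way_below b c \<Longrightarrow> way_below a (c::'a::order)"
  unfolding way_below_def by (meson order_trans)

lemma way_below_directed_lub:
  fixes a s :: "'a::continuous_domain"
  assumes a: "way_below a s" and C: "directed C" "is_lub C s"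
  shows "\<exists>c\<in>C. way_below a c"
proof -
  let ?E = "{x. \<exists>c\<in>C. way_below x c}"
  have dir: "directed ?E"
    unfolding directed_def
  proof (intro conjI ballI)
    obtain c where "c \<in> C" using C(1) by (auto simp: directed_def)
    moreover obtain x where "way_below x c"
      using directed_way_below[of c] by (auto simp: directed_def)
    ultimately show "?E \<noteq> {}" by blast
  next
    fix x y assume "x \<in> ?E" "y \<in> ?E"
    then obtain c d where c: "c \<in> C" "way_below x c" and d: "d \<in> C" "way_below y d" by blast
    then obtain e where e: "e \<in> C" "c \<le> e" "d \<le> e" using C(1) by (meson directed_def)
    then have "way_below x e" "way_below y e" using c d way_below_le_trans by blast+
    then obtain z where "way_below z e" "x \<le> z" "y \<le> z"
      using directed_way_below[of e] by (auto simp: directed_def)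
    with e show "\<exists>z\<in>?E. x \<le> z \<and> y \<le> z" by blast
  qed
  have lub: "is_lub ?E s"
    unfolding is_lub_def
  proof (intro conjI ballI allI impI)
    fix x assume "x \<in> ?E"
    then show "x \<le> s" using C(2) way_below_imp_le unfolding is_lub_def
      by (blast intro: order_trans)
  next
    fix u assume u: "\<forall>c\<in>?E. c \<le> u"
    have "c \<le> u" if "c \<in> C" for c
      using is_lub_way_below[of c] u that unfolding is_lub_def by blast
    then show "s \<le> u" using C(2) unfolding is_lub_def by blast
  qed
  obtain x where "x \<in> ?E" "a \<le> x"
    using a dir lub unfolding way_below_def by blast
  then show ?thesis using le_way_below_trans by blast
qed

text \<open>
  Over a domain the least element in the definition of \<^const>\<open>strongest_post\<close> exists and is given
  by regularizing the pointwise supremum.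
\<close>
lemma strongest_post_eq:
  fixes star :: "'l::complete_lattice \<Rightarrow> 'l \<Rightarrow> 'l"
    and \<phi> :: "'d::order \<Rightarrow> 'e::continuous_domain \<Rightarrow> 'l"
  assumes q: "unital_quantale star" and \<phi>: "range \<phi> \<subseteq> fuzzy_predicates"
  shows "strongest_post star \<phi> m b = (INF b'\<in>{b'. way_below b' b}. SUP a. star (m a) (\<phi> a b'))"
proof -
  interpret unital_quantale star by (rule q)
  define g where "g b = (INF b'\<in>{b'. way_below b' b}. SUP a. star (m a) (\<phi> a b'))" for b
  have star_mono: "star x y \<le> star x z" if "y \<le> z" for x y z
    using star_Sup[of x "{y, z}"] that by (simp add: sup.absorb2 le_iff_sup)
  have anti: "g c \<le> g b" if "b \<le> c" for b c
    unfolding g_def using that way_below_le_trans by (intro INF_superset_mono) blast+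
  have "g \<in> fuzzy_predicates"
    unfolding fuzzy_predicates_def
  proof (intro CollectI conjI allI impI)
    show "antimono g" using anti by (intro antimonoI)
    fix C :: "'e set" and s assume C: "directed C \<and> is_lub C s"
    show "g s = (INF c\<in>C. g c)"
    proof (rule antisym)
      show "g s \<le> (INF c\<in>C. g c)" using C anti by (intro INF_greatest) (auto simp: is_lub_def)
      have "(INF c\<in>C. g c) \<le> (SUP a. star (m a) (\<phi> a b'))" if b': "way_below b' s" for b'
      proof -
        obtain c where c: "c \<in> C" "way_below b' c" using way_below_directed_lub b' C by blast
        then have "(INF c\<in>C. g c) \<le> g c" by (intro INF_lower)
        also have "g c \<le> (SUP a. star (m a) (\<phi> a b'))" unfolding g_def using c by (intro INF_lower) simp
        finally show ?thesis .
      qed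
      then show "(INF c\<in>C. g c) \<le> g s" unfolding g_def[of s] by (intro INF_greatest) simp
    qed
  qed
  moreover have "star (m a) (\<phi> a b) \<le> g b" for a b
    unfolding g_def
  proof (rule INF_greatest)
    fix b' assume "b' \<in> {b'. way_below b' b}"
    then have "b' \<le> b" using way_below_imp_le by blast
    moreover have "antimono (\<phi> a)" using \<phi> by (auto simp: fuzzy_predicates_def)
    ultimately have "star (m a) (\<phi> a b) \<le> star (m a) (\<phi> a b')"
      by (intro star_mono) (auto dest: antimonoD)
    also have "\<dots> \<le> (SUP a. star (m a) (\<phi> a b'))" by (intro SUP_upper) simp
    finally show "star (m a) (\<phi> a b) \<le> (SUP a. star (m a) (\<phi> a b'))" .
  qed
  moreover have "g \<le> m'" if m': "m' \<in> fuzzy_predicates" "\<forall>a b. star (m a) (\<phi> a b) \<le> m' b" for m'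
  proof (rule le_funI)
    fix b
    have "g b \<le> (INF b'\<in>{b'. way_below b' b}. m' b')"
      unfolding g_def using m'(2) by (intro INF_mono' SUP_least) blast
    also have "\<dots> = m' b"
      using m'(1) directed_way_below[of b] is_lub_way_below[of b]
      unfolding fuzzy_predicates_def by auto
    finally show "g b \<le> m' b" .
  qed
  ultimately have "strongest_post star \<phi> m = g"
    unfolding strongest_post_def by (intro Least_equality) blast+
  then show ?thesis by (simp add: g_def)
qed

end

theory Submission
  imports Defs
begin

text \<open>
  Write \<open>f m b\<close> for the supremum of \<open>star (m a) (\<phi> a b)\<close> over all \<open>a\<close>. The formula and the lower
  continuity of the strongest postcondition are two instances of one semicontinuity property of
  the map \<open>(m, b) \<mapsto> f m b\<close> for lower continuous \<open>\<phi>\<close>: a lower bound \<open>g\<close> of the values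
  \<open>f (m i) (b i)\<close> survives the passage to a limit of \<open>m i\<close> and \<open>b i\<close> along an ultrafilter
  (\<open>transport_limit\<close>). With \<open>m\<close> constant and \<open>b i\<close> running through a directed set this says that
  \<open>f m\<close> turns directed suprema into
  infima, so that \<open>f m\<close> is a predicate, hence the least one above all \<open>star (m a) (\<phi> a b)\<close>. With
  \<open>b\<close> constant it says that the inverse images under \<open>f\<close> of principal filters are closed.

  The reason for semicontinuity is compactness of a complete continuous semilattice. A supremum
  above \<open>g\<close> need not be attained, but by complete distributivity every \<open>\<delta>\<close> totally below \<open>g\<close> lies
  below a single \<open>star (m i (a i)) (\<phi> (a i) (b i))\<close>. Along an ultrafilter the \<open>a i\<close> converge, in
  the lower topology, to the supremum \<open>\<ell>\<close> of their eventual lower bounds, so \<open>\<phi> (a i)\<close> converges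
  to \<open>\<phi> \<ell>\<close> if \<open>\<phi>\<close> is lower continuous. Since \<open>\<ell>\<close> is a directed supremum of elements
  eventually below \<open>a i\<close>, and predicates are antitone and turn such suprema into infima, the
  evaluation of a predicate at a point is upper semicontinuous for these limits
  (\<open>Limsup_evaluation_le\<close>). Distributivity of \<open>star\<close> over infima then gives
  \<open>\<delta> \<le> star (m \<ell>) (\<phi> \<ell> b)\<close> for the limits \<open>m\<close> and \<open>b\<close>.

  Conversely, \<open>\<phi>\<close> factors through its strongest postcondition: it is the composite with the
  embedding of \<open>'d\<close> into the predicates that sends \<open>a\<close> to the characteristic function of the
  elements below \<open>a\<close>, and this embedding is lower continuous.
\<close>

section \<open>Ultrafilters\<close>

definition ultrafilter :: "'a filter \<Rightarrow> bool"
  where "ultrafilter F \<longleftrightarrow>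
    F \<noteq> bot \<and> (\<forall>P. eventually P F \<or> eventually (\<lambda>x. \<not> P x) F)"

lemma ultrafilter_below:
  fixes F :: "'a filter"
  assumes "F \<noteq> bot"
  shows "\<exists>U. ultrafilter U \<and> U \<le> F"
proof -
  define A where "A = {G. G \<noteq> bot \<and> G \<le> F}"
  have "\<exists>m\<in>A. \<forall>a\<in>A. m \<ge> a \<longrightarrow> a = m"
  proof (rule predicate_Zorn)
    show "partial_order_on A (relation_of (\<ge>) A)"
      by (rule partial_order_on_relation_ofI) auto
    fix C assume C: "C \<in> Chains (relation_of (\<ge>) A)"
    then have CA: "C \<subseteq> A" and total: "\<And>G H. G \<in> C \<Longrightarrow> H \<in> C \<Longrightarrow> G \<le> H \<or> H \<le> G"
      by (auto simp: Chains_def relation_of_def)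
    show "\<exists>u\<in>A. \<forall>a\<in>C. u \<le> a"
    proof (cases "C = {}")
      case True
      then show ?thesis using assms by (auto simp: A_def)
    next
      case False
      have "eventually P (Inf C) \<longleftrightarrow> (\<exists>G\<in>C. eventually P G)" for P
        using False total by (intro eventually_Inf_base) (auto simp: inf.absorb1 inf.absorb2)
      then have "Inf C \<noteq> bot"
        using CA by (auto simp: trivial_limit_def A_def)
      moreover have "Inf C \<le> F"
        using False CA by (auto simp: A_def intro: Inf_lower2)
      ultimately show ?thesis by (auto simp: A_def intro: Inf_lower)
    qed
  qed
  then obtain U where U: "U \<in> A" and maximal: "\<And>G. G \<in> A \<Longrightarrow> G \<le> U \<Longrightarrow> G = U" by blast
  have "eventually P U \<or> eventually (\<lambda>x. \<not> P x) U" for P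
  proof (cases "inf U (principal {x. P x}) = bot")
    case True
    then show ?thesis
      by (simp add: trivial_limit_def eventually_inf_principal)
  next
    case False
    then have "inf U (principal {x. P x}) = U"
      using U by (intro maximal) (auto simp: A_def intro: le_infI1)
    then have "U \<le> principal {x. P x}" by (metis inf.orderI)
    then show ?thesis by (simp add: le_principal)
  qed
  then show ?thesis using U by (auto simp: ultrafilter_def A_def)
qed

lemma closedin_ultrafilter_limits:
  assumes "S \<subseteq> topspace X"
    and "\<And>F l. \<lbrakk>ultrafilter F; eventually (\<lambda>x. x \<in> S) F; limitin X (\<lambda>x. x) l F\<rbrakk> \<Longrightarrow> l \<in> S"
  shows "closedin X S"
proof -
  have "X closure_of S \<subseteq> S"
  proof
    fix l assume l: "l \<in> X closure_of S"
    then have lX: "l \<in> topspace X" by (simp add: in_closure_of)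
    have "inf (nhdsin X l) (principal S) \<noteq> bot"
      using l unfolding trivial_limit_def eventually_inf_principal eventually_nhdsin
      by (auto simp: in_closure_of)
    then obtain F where F: "ultrafilter F" "F \<le> inf (nhdsin X l) (principal S)"
      using ultrafilter_below by blast
    have "eventually (\<lambda>x. x \<in> S) F" using F(2) by (simp add: le_principal)
    moreover have "limitin X (\<lambda>x. x) l F"
      unfolding limitin_def
    proof (intro conjI lX allI impI)
      fix V assume "openin X V \<and> l \<in> V"
      then have "eventually (\<lambda>x. x \<in> V) (nhdsin X l)" by (auto simp: eventually_nhdsin)
      then show "eventually (\<lambda>x. x \<in> V) F" using F(2) by (auto intro: filter_leD)
    qed
    ultimately show "l \<in> S" using assms(2) F(1) by blast
  qed
  then show ?thesis using assms(1) closure_of_subset_eq by blast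
qed

section \<open>The lower topology\<close>

lemma topspace_lower_topology [simp]: "topspace (lower_topology X) = X"
  unfolding lower_topology_def by auto

lemma openin_lower_topology_not_above:
  "b \<in> X \<Longrightarrow> openin (lower_topology X) (X - {a \<in> X. b \<le> a})"
  unfolding lower_topology_def by (intro topology_generated_by_Basis) blast

lemma closedin_lower_topology_above:
  "b \<in> X \<Longrightarrow> closedin (lower_topology X) {a \<in> X. b \<le> a}"
  by (auto simp: closedin_def openin_lower_topology_not_above)

lemma lower_continuousI:
  assumes "f ` X \<subseteq> Y"
    and "\<And>b. b \<in> Y \<Longrightarrow> closedin (lower_topology X) {a \<in> X. b \<le> f a}"
  shows "lower_continuous X Y f"
  unfolding lower_continuous_def
proof (subst lower_topology_def[of Y], rule continuous_on_generated_topo)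
  fix U assume "U \<in> insert Y {Y - {a \<in> Y. b \<le> a} |b. b \<in> Y}"
  then consider "U = Y" | b where "b \<in> Y" "U = Y - {a \<in> Y. b \<le> a}" by blast
  then show "openin (lower_topology X) (f -` U \<inter> topspace (lower_topology X))"
  proof cases
    case 1
    then have "f -` U \<inter> topspace (lower_topology X) = topspace (lower_topology X)"
      using assms(1) by auto
    then show ?thesis by (metis openin_topspace)
  next
    case 2
    then have "f -` U \<inter> topspace (lower_topology X) = topspace (lower_topology X) - {a \<in> X. b \<le> f a}"
      using assms(1) by auto
    then show ?thesis using assms(2)[OF 2(1)] by (simp add: closedin_def)
  qed
qed (use assms(1) in auto)

lemma lower_limit_ge:
  assumes "limitin (lower_topology X) f l F" "F \<noteq> bot"
    and "n \<in> X" "eventually (\<lambda>i. n \<le> f i) F"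
  shows "n \<le> l"
proof (rule ccontr)
  assume "\<not> n \<le> l"
  then have "l \<in> X - {a \<in> X. n \<le> a}" using limitin_topspace[OF assms(1)] by simp
  then have "eventually (\<lambda>i. f i \<in> X - {a \<in> X. n \<le> a}) F"
    using assms(1,3) openin_lower_topology_not_above by (blast intro: limitinD)
  with assms(4) have "eventually (\<lambda>i. False) F" by eventually_elim auto
  then show False using assms(2) by simp
qed

section \<open>Limits along ultrafilters in complete semilattices\<close>

lemma directed_eventual_lower_bounds:
  fixes x :: "'i \<Rightarrow> 'a::complete_continuous_semilattice"
  assumes "F \<noteq> bot"
  shows "directed {y. eventually (\<lambda>i. y \<le> x i) F}"
  unfolding directed_def
proof (intro conjI ballI)
  obtain y where "is_glb (UNIV :: 'a set) y" using nonempty_has_glb by blast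
  then have "y \<in> {y. eventually (\<lambda>i. y \<le> x i) F}" by (simp add: is_glb_def)
  then show "{y. eventually (\<lambda>i. y \<le> x i) F} \<noteq> {}" by blast
next
  fix y z assume "y \<in> {y. eventually (\<lambda>i. y \<le> x i) F}" "z \<in> {y. eventually (\<lambda>i. y \<le> x i) F}"
  then have ev: "eventually (\<lambda>i. y \<le> x i \<and> z \<le> x i) F" by (simp add: eventually_conj)
  let ?S = "x ` {i. y \<le> x i \<and> z \<le> x i}"
  have "?S \<noteq> {}" using ev assms eventually_happens' by fastforce
  \<comment> \<open>\<open>y\<close> and \<open>z\<close> need not have a join, but they have the infimum of a tail as an upper bound.\<close>
  then obtain w where w: "is_glb ?S w" by (rule nonempty_has_glb[THEN exE])
  have "eventually (\<lambda>i. w \<le> x i) F"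
    using ev by (rule eventually_mono) (use w in \<open>unfold is_glb_def, blast\<close>)
  moreover have "y \<le> w \<and> z \<le> w" using w unfolding is_glb_def by blast
  ultimately show "\<exists>w\<in>{y. eventually (\<lambda>i. y \<le> x i) F}. y \<le> w \<and> z \<le> w" by blast
qed

text \<open>
  For an ultrafilter, failing to be eventually above \<open>b\<close> is the same as being eventually in the
  open complement of the principal filter of \<open>b\<close>; this is why the limit inferior is a limit.
\<close>
lemma limitin_lower_topology_liminf:
  fixes x :: "'i \<Rightarrow> 'a::order"
  assumes F: "ultrafilter F" and l: "is_lub {y. eventually (\<lambda>i. y \<le> x i) F} l"
  shows "limitin (lower_topology UNIV) x l F"
proof -
  have "l \<in> U \<longrightarrow> eventually (\<lambda>i. x i \<in> U) F"
    if "generate_topology_on (insert UNIV {UNIV - {a \<in> UNIV. b \<le> a} | b. b \<in> UNIV}) U" for U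
    using that
  proof induction
    case (Int a b)
    then show ?case by (auto intro: eventually_conj)
  next
    case (UN K)
    show ?case
    proof
      assume "l \<in> \<Union>K"
      then obtain k where k: "k \<in> K" "l \<in> k" by blast
      then have "eventually (\<lambda>i. x i \<in> k) F" using UN.IH by blast
      then show "eventually (\<lambda>i. x i \<in> \<Union>K) F"
        by (rule eventually_mono) (use k(1) in blast)
    qed
  next
    case (Basis s)
    then consider "s = UNIV" | b where "s = UNIV - {a \<in> UNIV. b \<le> a}" by blast
    then show ?case
    proof cases
      case 2
      show ?thesis
      proof
        assume "l \<in> s"
        then have "\<not> eventually (\<lambda>i. b \<le> x i) F" using l 2 by (auto simp: is_lub_def)
        then have "eventually (\<lambda>i. \<not> b \<le> x i) F" using F by (auto simp: ultrafilter_def)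
        then show "eventually (\<lambda>i. x i \<in> s) F" using 2 by simp
      qed
    qed simp
  qed simp
  then show ?thesis
    unfolding limitin_def lower_topology_def openin_topology_generated_by_iff
    by (auto simp: topology_generated_by_topspace)
qed

section \<open>Approximation in completely distributive lattices\<close>

definition totally_below :: "'l::complete_lattice \<Rightarrow> 'l \<Rightarrow> bool"
  where "totally_below x y \<longleftrightarrow> (\<forall>S. y \<le> Sup S \<longrightarrow> (\<exists>s\<in>S. x \<le> s))"

text \<open>
  Apply complete distributivity to the family of all sets \<open>S\<close> whose supremum is above \<open>y\<close>: for a
  choice function on this family, the infimum of the chosen elements is totally below \<open>y\<close>.
\<close>
lemma le_if_totally_below_le:
  fixes y z :: "'l::complete_distrib_lattice"
  assumes "\<And>x. totally_below x y \<Longrightarrow> x \<le> z"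
  shows "y \<le> z"
proof -
  let ?A = "{S. y \<le> Sup S}"
  have "y \<le> Inf (Sup ` ?A)" by (auto intro: Inf_greatest)
  also have "\<dots> \<le> Sup (Inf ` {f ` ?A | f. \<forall>Y\<in>?A. f Y \<in> Y})" by (rule Inf_Sup_le)
  also have "\<dots> \<le> z"
  proof (rule Sup_least)
    fix x assume "x \<in> Inf ` {f ` ?A | f. \<forall>Y\<in>?A. f Y \<in> Y}"
    then obtain f where f: "\<forall>Y\<in>?A. f Y \<in> Y" and x: "x = Inf (f ` ?A)" by auto
    have "totally_below x y"
      unfolding totally_below_def x using f by (blast intro: Inf_lower)
    then show "x \<le> z" by (rule assms)
  qed
  finally show ?thesis .
qed

lemma eventually_totally_below_Limsup:
  assumes "ultrafilter F" "totally_below x (Limsup F u)"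
  shows "eventually (\<lambda>i. x \<le> u i) F"
proof (rule ccontr)
  assume "\<not> ?thesis"
  then have "eventually (\<lambda>i. \<not> x \<le> u i) F" using assms(1) by (auto simp: ultrafilter_def)
  then have "Limsup F u \<le> (SUP i\<in>{i. \<not> x \<le> u i}. u i)"
    unfolding Limsup_def by (auto intro: INF_lower2)
  then show False using assms(2) unfolding totally_below_def by fastforce
qed

section \<open>Predicates\<close>

lemma fuzzy_predicatesD:
  assumes "m \<in> fuzzy_predicates"
  shows "x \<le> y \<Longrightarrow> m y \<le> m x" "directed C \<Longrightarrow> is_lub C s \<Longrightarrow> m s = (INF c\<in>C. m c)"
  using assms unfolding fuzzy_predicates_def by (blast dest: antimonoD)+

lemma fuzzy_predicatesI:
  fixes m :: "'a::order \<Rightarrow> 'l::complete_lattice"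
  assumes "\<And>x y. x \<le> y \<Longrightarrow> m y \<le> m x"
    and "\<And>C s. \<lbrakk>directed C; is_lub C s\<rbrakk> \<Longrightarrow> (INF c\<in>C. m c) \<le> m s"
  shows "m \<in> fuzzy_predicates"
  unfolding fuzzy_predicates_def
proof (intro CollectI conjI allI impI)
  show "antimono m" using assms(1) by (rule antimonoI)
  fix C :: "'a set" and s assume C: "directed C \<and> is_lub C s"
  show "m s = (INF c\<in>C. m c)"
  proof (rule order.antisym)
    show "m s \<le> (INF c\<in>C. m c)"
      using C by (intro INF_greatest assms(1)) (simp add: is_lub_def)
    show "(INF c\<in>C. m c) \<le> m s" using C assms(2) by blast
  qed
qed

definition step_predicate :: "'d::order \<Rightarrow> 'l::complete_lattice \<Rightarrow> 'd \<Rightarrow> 'l"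
  where "step_predicate x \<alpha> = (\<lambda>y. if y \<le> x then \<alpha> else bot)"

lemma step_predicate_in_fuzzy_predicates:
  fixes x :: "'a::order"
  shows "step_predicate x \<alpha> \<in> fuzzy_predicates"
proof (rule fuzzy_predicatesI)
  fix C :: "'a set" and s assume C: "directed C" "is_lub C s"
  show "(INF c\<in>C. step_predicate x \<alpha> c) \<le> step_predicate x \<alpha> s"
  proof (cases "s \<le> x")
    case True
    obtain c where "c \<in> C" using C by (auto simp: directed_def)
    moreover have "step_predicate x \<alpha> c \<le> step_predicate x \<alpha> s"
      using True by (simp add: step_predicate_def)
    ultimately show ?thesis by (rule INF_lower2)
  next
    case False
    then obtain c where "c \<in> C" "\<not> c \<le> x" using C by (auto simp: is_lub_def)
    then show ?thesis by (intro INF_lower2[of c]) (auto simp: step_predicate_def)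
  qed
next
  fix y z :: 'a assume "y \<le> z"
  then have "z \<le> x \<Longrightarrow> y \<le> x" by (rule order_trans)
  then show "step_predicate x \<alpha> z \<le> step_predicate x \<alpha> y" by (auto simp: step_predicate_def)
qed

lemma step_predicate_le_iff:
  assumes "m \<in> fuzzy_predicates"
  shows "step_predicate x \<alpha> \<le> m \<longleftrightarrow> \<alpha> \<le> m x"
proof
  show "\<alpha> \<le> m x" if "step_predicate x \<alpha> \<le> m"
    using le_funD[OF that, of x] by (simp add: step_predicate_def)
  show "step_predicate x \<alpha> \<le> m" if "\<alpha> \<le> m x"
    using order_trans[OF that fuzzy_predicatesD(1)[OF assms]]
    by (simp add: step_predicate_def le_fun_def)
qed

text \<open>
  If \<open>\<alpha>\<close> is eventually below \<open>m i (x i)\<close> and \<open>y\<close> is eventually below \<open>x i\<close>, then the step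
  predicate of \<open>y\<close> and \<open>\<alpha>\<close> is eventually below \<open>m i\<close>, hence below the limit \<open>m'\<close>; so \<open>\<alpha> \<le> m' y\<close>,
  and \<open>m' l\<close> is the infimum of these values.
\<close>
lemma Limsup_evaluation_le:
  fixes x :: "'i \<Rightarrow> 'd::complete_continuous_semilattice"
    and m :: "'i \<Rightarrow> 'd \<Rightarrow> 'l::complete_distrib_lattice"
  assumes F: "ultrafilter F"
    and l: "is_lub {y. eventually (\<lambda>i. y \<le> x i) F} l"
    and m: "\<And>i. m i \<in> fuzzy_predicates"
    and lim: "limitin (lower_topology fuzzy_predicates) m m' F"
  shows "Limsup F (\<lambda>i. m i (x i)) \<le> m' l"
proof (rule le_if_totally_below_le)
  fix \<alpha> assume "totally_below \<alpha> (Limsup F (\<lambda>i. m i (x i)))"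
  with F have \<alpha>: "eventually (\<lambda>i. \<alpha> \<le> m i (x i)) F" by (rule eventually_totally_below_Limsup)
  have nontrivial: "F \<noteq> bot" using F by (simp add: ultrafilter_def)
  have m': "m' \<in> fuzzy_predicates" using limitin_topspace[OF lim] by simp
  have "\<alpha> \<le> m' y" if "eventually (\<lambda>i. y \<le> x i) F" for y
  proof -
    have "eventually (\<lambda>i. step_predicate y \<alpha> \<le> m i) F"
      using that \<alpha>
    proof eventually_elim
      case (elim i)
      have "\<alpha> \<le> m i y" using elim(2) fuzzy_predicatesD(1)[OF m elim(1)] by (rule order_trans)
      then show ?case by (simp add: step_predicate_le_iff[OF m])
    qed
    then have "step_predicate y \<alpha> \<le> m'"
      by (rule lower_limit_ge[OF lim nontrivial step_predicate_in_fuzzy_predicates])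
    then show ?thesis by (simp add: step_predicate_le_iff[OF m'])
  qed
  moreover have "m' l = (INF y\<in>{y. eventually (\<lambda>i. y \<le> x i) F}. m' y)"
    using m' directed_eventual_lower_bounds[OF nontrivial] l by (rule fuzzy_predicatesD(2))
  ultimately show "\<alpha> \<le> m' l" by (auto intro: INF_greatest)
qed

section \<open>The pointwise supremum\<close>

context unital_quantale
begin

lemma star_mono:
  assumes "x \<le> x'" "y \<le> y'"
  shows "star x y \<le> star x' y'"
proof -
  have "star x y \<le> star x y'"
    using star_Sup[of x "{y, y'}"] assms by (simp add: sup.absorb2 le_iff_sup)
  also have "\<dots> \<le> star x' y'"
    using Sup_star[of "{x, x'}" y'] assms by (simp add: sup.absorb2 le_iff_sup)
  finally show ?thesis .
qed

lemma bot_star [simp]: "star bot x = bot"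
  using Sup_star[of "{}" x] by simp

lemma le_star_Limsup:
  assumes "inf_distributive star" "F \<noteq> bot" "eventually (\<lambda>i. \<delta> \<le> star (u i) (v i)) F"
  shows "\<delta> \<le> star (Limsup F u) (Limsup F v)"
proof -
  let ?E = "{P. eventually P F}"
  have "?E \<noteq> {}" using eventually_True by blast
  then have "star (Limsup F u) (Limsup F v) =
      (INF P\<in>?E. INF Q\<in>?E. star (SUP i\<in>Collect P. u i) (SUP i\<in>Collect Q. v i))"
    using assms(1)
    by (simp add: Limsup_def inf_distributive_def image_image) (rule INF_commute)
  moreover have "\<delta> \<le> star (SUP i\<in>Collect P. u i) (SUP i\<in>Collect Q. v i)"
    if "eventually P F" "eventually Q F" for P Q
  proof -
    have "eventually (\<lambda>i. P i \<and> Q i \<and> \<delta> \<le> star (u i) (v i)) F"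
      using that assms(3) by (simp add: eventually_conj)
    then obtain i where "P i" "Q i" "\<delta> \<le> star (u i) (v i)"
      using assms(2) eventually_happens' by blast
    moreover from this have "star (u i) (v i) \<le> star (SUP i\<in>Collect P. u i) (SUP i\<in>Collect Q. v i)"
      by (intro star_mono SUP_upper) auto
    ultimately show ?thesis by (blast intro: order_trans)
  qed
  ultimately show ?thesis by (auto intro!: INF_greatest)
qed

end

definition transport ::
    "('l::complete_lattice \<Rightarrow> 'l \<Rightarrow> 'l) \<Rightarrow> ('d \<Rightarrow> 'e \<Rightarrow> 'l) \<Rightarrow> ('d \<Rightarrow> 'l) \<Rightarrow> 'e \<Rightarrow> 'l"
  where "transport star \<phi> m b = (SUP a. star (m a) (\<phi> a b))"

text \<open>
  For \<open>\<delta>\<close> totally below \<open>g\<close> choose \<open>a i\<close> with \<open>\<delta> \<le> star (m i (a i)) (\<phi> (a i) (b i))\<close>. Evaluation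
  is upper semicontinuous both for \<open>m i\<close> at \<open>a i\<close> and for \<open>\<phi> (a i)\<close> at \<open>b i\<close>, so the limit of the
  \<open>a i\<close> is a point that witnesses \<open>\<delta>\<close> for \<open>m'\<close> and \<open>b'\<close>.
\<close>
lemma transport_limit:
  fixes star :: "'l::complete_distrib_lattice \<Rightarrow> 'l \<Rightarrow> 'l"
    and \<phi> :: "'d::complete_continuous_semilattice \<Rightarrow> 'e::complete_continuous_semilattice \<Rightarrow> 'l"
    and m :: "'i \<Rightarrow> 'd \<Rightarrow> 'l"
  assumes q: "unital_quantale star" and inf_distr: "inf_distributive star"
    and \<phi>: "range \<phi> \<subseteq> fuzzy_predicates" "lower_continuous UNIV fuzzy_predicates \<phi>"
    and F: "ultrafilter F"
    and m: "\<And>i. m i \<in> fuzzy_predicates"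
    and m': "limitin (lower_topology fuzzy_predicates) m m' F"
    and b': "is_lub {y. eventually (\<lambda>i. y \<le> b i) F} b'"
    and g: "eventually (\<lambda>i. g \<le> transport star \<phi> (m i) (b i)) F"
  shows "g \<le> transport star \<phi> m' b'"
proof (rule le_if_totally_below_le)
  interpret unital_quantale star by (rule q)
  have nontrivial: "F \<noteq> bot" using F by (simp add: ultrafilter_def)
  fix \<delta> assume \<delta>: "totally_below \<delta> g"
  define a where "a i = (SOME a. \<delta> \<le> star (m i a) (\<phi> a (b i)))" for i
  have \<delta>_le: "eventually (\<lambda>i. \<delta> \<le> star (m i (a i)) (\<phi> (a i) (b i))) F"
    using g
  proof eventually_elim
    case (elim i)
    then have "\<exists>a. \<delta> \<le> star (m i a) (\<phi> a (b i))"
      using \<delta> unfolding totally_below_def transport_def by blast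
    then show ?case unfolding a_def by (rule someI_ex)
  qed
  obtain l where l: "is_lub {y. eventually (\<lambda>i. y \<le> a i) F} l"
    using directed_has_lub directed_eventual_lower_bounds[OF nontrivial] by blast
  have "limitin (lower_topology fuzzy_predicates) (\<phi> \<circ> a) (\<phi> l) F"
    using \<phi>(2) limitin_lower_topology_liminf[OF F l]
    unfolding lower_continuous_def by (rule continuous_map_limit)
  then have \<phi>_l: "Limsup F (\<lambda>i. \<phi> (a i) (b i)) \<le> \<phi> l b'"
    using Limsup_evaluation_le[OF F b', of "\<phi> \<circ> a"] \<phi>(1) by auto
  have m_l: "Limsup F (\<lambda>i. m i (a i)) \<le> m' l"
    using Limsup_evaluation_le[OF F l m m'] .
  have "\<delta> \<le> star (Limsup F (\<lambda>i. m i (a i))) (Limsup F (\<lambda>i. \<phi> (a i) (b i)))"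
    using inf_distr nontrivial \<delta>_le by (rule le_star_Limsup)
  also have "\<dots> \<le> star (m' l) (\<phi> l b')" using m_l \<phi>_l by (rule star_mono)
  also have "\<dots> \<le> transport star \<phi> m' b'" unfolding transport_def by (rule SUP_upper) simp
  finally show "\<delta> \<le> transport star \<phi> m' b'" .
qed

lemma transport_in_fuzzy_predicates:
  fixes star :: "'l::complete_distrib_lattice \<Rightarrow> 'l \<Rightarrow> 'l"
    and \<phi> :: "'d::complete_continuous_semilattice \<Rightarrow> 'e::complete_continuous_semilattice \<Rightarrow> 'l"
  assumes q: "unital_quantale star" and inf_distr: "inf_distributive star"
    and \<phi>: "range \<phi> \<subseteq> fuzzy_predicates" "lower_continuous UNIV fuzzy_predicates \<phi>"
    and m: "m \<in> fuzzy_predicates"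
  shows "transport star \<phi> m \<in> fuzzy_predicates"
proof (rule fuzzy_predicatesI)
  interpret unital_quantale star by (rule q)
  show "transport star \<phi> m y \<le> transport star \<phi> m x" if "x \<le> y" for x y
    unfolding transport_def
  proof (rule SUP_mono')
    fix a
    have "\<phi> a y \<le> \<phi> a x" using that \<phi>(1) by (intro fuzzy_predicatesD(1)[of "\<phi> a"]) auto
    then show "star (m a) (\<phi> a y) \<le> star (m a) (\<phi> a x)" by (intro star_mono order_refl)
  qed
  fix C :: "'e set" and s assume C: "directed C" "is_lub C s"
  \<comment> \<open>The limit is taken along an ultrafilter on the points of \<open>C\<close> that contains all tails of \<open>C\<close>.\<close>
  define G where "G = (INF c\<in>C. principal {x \<in> C. c \<le> x})"
  have "G \<noteq> bot"
  proof -
    have "\<exists>k\<in>C. principal {x \<in> C. k \<le> x} \<le> inf (principal {x \<in> C. i \<le> x}) (principal {x \<in> C. j \<le> x})"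
      if "i \<in> C" "j \<in> C" for i j
    proof -
      obtain k where k: "k \<in> C" "i \<le> k" "j \<le> k" using C(1) \<open>i \<in> C\<close> \<open>j \<in> C\<close>
        unfolding directed_def by blast
      then show ?thesis using order_trans[OF k(2)] order_trans[OF k(3)] by (intro bexI[of _ k]) auto
    qed
    then have "G = bot \<longleftrightarrow> (\<exists>c\<in>C. principal {x \<in> C. c \<le> x} = bot)"
      unfolding G_def by (rule INF_filter_bot_base)
    then show ?thesis by (auto simp: principal_eq_bot_iff)
  qed
  then obtain F where F: "ultrafilter F" "F \<le> G" using ultrafilter_below by blast
  have tail: "eventually (\<lambda>x. x \<in> C \<and> c \<le> x) F" if "c \<in> C" for c
  proof -
    have "eventually (\<lambda>x. x \<in> C \<and> c \<le> x) G"
      unfolding G_def using that by (intro eventually_INF1[of c]) (auto simp: eventually_principal)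
    then show ?thesis using F(2) by (rule filter_leD[rotated])
  qed
  obtain c0 where "c0 \<in> C" using C(1) by (auto simp: directed_def)
  then have in_C: "eventually (\<lambda>x. x \<in> C) F"
    by (rule eventually_mono[OF tail]) simp
  have lub: "is_lub {y. eventually (\<lambda>x. y \<le> x) F} s"
    unfolding is_lub_def
  proof (intro conjI ballI allI impI)
    fix y assume "y \<in> {y. eventually (\<lambda>x. y \<le> x) F}"
    then have "eventually (\<lambda>x. y \<le> x \<and> x \<in> C) F" using in_C by (simp add: eventually_conj)
    then obtain x where "y \<le> x" "x \<in> C"
      using F(1) eventually_happens' unfolding ultrafilter_def by blast
    moreover from this have "x \<le> s" using C(2) by (simp add: is_lub_def)
    ultimately show "y \<le> s" by (blast intro: order_trans)
  next
    fix u assume u: "\<forall>c\<in>{y. eventually (\<lambda>x. y \<le> x) F}. c \<le> u"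
    have "c \<le> u" if "c \<in> C" for c
    proof -
      have "eventually (\<lambda>x. c \<le> x) F" by (rule eventually_mono[OF tail[OF that]]) simp
      then show ?thesis using u by simp
    qed
    then show "s \<le> u" using C(2) by (auto simp: is_lub_def)
  qed
  have "eventually (\<lambda>x. (INF c\<in>C. transport star \<phi> m c) \<le> transport star \<phi> m x) F"
    using in_C by eventually_elim (rule INF_lower)
  then show "(INF c\<in>C. transport star \<phi> m c) \<le> transport star \<phi> m s"
    using transport_limit[OF q inf_distr \<phi> F(1) _ _ lub, of "\<lambda>_. m" m] m by simp
qed

section \<open>Strongest postconditions\<close>

lemma strongest_post_eq_transport:
  assumes "transport star \<phi> m \<in> fuzzy_predicates"
  shows "strongest_post star \<phi> m = transport star \<phi> m"
  unfolding strongest_post_def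
  by (rule Least_equality)
    (use assms in \<open>auto simp: transport_def le_fun_def intro: SUP_upper SUP_least\<close>)

text \<open>
  The characteristic function of the elements below \<open>a\<close> is above \<open>n\<close> iff \<open>a\<close> is an upper bound of
  the support of \<open>n\<close>, so the inverse images of principal filters are intersections of such filters.
\<close>
lemma lower_continuous_characteristic:
  "lower_continuous UNIV fuzzy_predicates
    (\<lambda>a :: 'd::order. step_predicate a (top :: 'l::complete_lattice))"
proof (rule lower_continuousI)
  fix n :: "'d \<Rightarrow> 'l"
  have "{a \<in> UNIV. n \<le> step_predicate a top} =
      topspace (lower_topology UNIV) \<inter> (\<Inter>x\<in>{x. n x \<noteq> bot}. {a \<in> UNIV. x \<le> a})"
    by (auto simp: step_predicate_def le_fun_def bot_unique split: if_splits)
  moreover have "closedin (lower_topology UNIV)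
      (topspace (lower_topology UNIV) \<inter> (\<Inter>x\<in>{x. n x \<noteq> bot}. {a :: 'd \<in> UNIV. x \<le> a}))"
  proof (cases "{x. n x \<noteq> bot} = {}")
    case False
    then show ?thesis
      by (intro closedin_Int closedin_topspace closedin_INT closedin_lower_topology_above) auto
  next
    case True
    then show ?thesis using closedin_topspace[of "lower_topology (UNIV :: 'd set)"] by simp
  qed
  ultimately show "closedin (lower_topology UNIV) {a \<in> UNIV. n \<le> step_predicate a top}" by simp
qed (auto simp: step_predicate_in_fuzzy_predicates)

text \<open>
  In the pointwise supremum for the characteristic function of the elements below \<open>a\<close>, the term
  at \<open>x\<close> is \<open>\<phi> x b\<close> if \<open>x \<le> a\<close> and \<open>bot\<close> otherwise. As \<open>\<phi>\<close> is isotone, the largest term is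
  \<open>\<phi> a b\<close>; and \<open>\<phi> a\<close> is already a predicate.
\<close>
lemma strongest_post_characteristic:
  fixes \<phi> :: "'d::order \<Rightarrow> 'e::order \<Rightarrow> 'l::complete_lattice"
  assumes q: "unital_quantale star" and \<phi>: "range \<phi> \<subseteq> fuzzy_predicates" "mono \<phi>"
  shows "strongest_post star \<phi> (step_predicate a top) = \<phi> a"
proof -
  interpret unital_quantale star by (rule q)
  have "transport star \<phi> (step_predicate a top) = \<phi> a"
  proof (rule ext, rule order.antisym)
    fix b
    show "transport star \<phi> (step_predicate a top) b \<le> \<phi> a b"
      unfolding transport_def using monoD[OF \<phi>(2)]
      by (intro SUP_least) (auto simp: step_predicate_def le_fun_def)
    show "\<phi> a b \<le> transport star \<phi> (step_predicate a top) b"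
      unfolding transport_def by (rule SUP_upper2[of a]) (auto simp: step_predicate_def)
  qed
  then show ?thesis using strongest_post_eq_transport \<phi>(1) by (metis range_subsetD)
qed

lemma lower_continuous_transport:
  fixes star :: "'l::complete_distrib_lattice \<Rightarrow> 'l \<Rightarrow> 'l"
    and \<phi> :: "'d::complete_continuous_semilattice \<Rightarrow> 'e::complete_continuous_semilattice \<Rightarrow> 'l"
  assumes q: "unital_quantale star" and inf_distr: "inf_distributive star"
    and \<phi>: "range \<phi> \<subseteq> fuzzy_predicates" "lower_continuous UNIV fuzzy_predicates \<phi>"
  shows "lower_continuous fuzzy_predicates fuzzy_predicates (transport star \<phi>)"
proof (rule lower_continuousI)
  show "transport star \<phi> ` fuzzy_predicates \<subseteq> fuzzy_predicates"
    using transport_in_fuzzy_predicates[OF assms] by blast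
  fix n :: "'e \<Rightarrow> 'l"
  let ?S = "{m \<in> fuzzy_predicates. n \<le> transport star \<phi> m}"
  show "closedin (lower_topology fuzzy_predicates) ?S"
  proof (rule closedin_ultrafilter_limits)
    fix F :: "('d \<Rightarrow> 'l) filter" and m'
    assume F: "ultrafilter F" and S: "eventually (\<lambda>m. m \<in> ?S) F"
      and lim: "limitin (lower_topology fuzzy_predicates) (\<lambda>m. m) m' F"
    \<comment> \<open>Off the set of predicates the identity is replaced by \<open>m'\<close>, which does not affect limits.\<close>
    define r where "r m = (if m \<in> fuzzy_predicates then m else m')" for m
    have m': "m' \<in> fuzzy_predicates" using limitin_topspace[OF lim] by simp
    have r: "r m \<in> fuzzy_predicates" for m using m' by (simp add: r_def)
    have r_eq: "eventually (\<lambda>m. r m = m) F" using S by eventually_elim (simp add: r_def)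
    have lim_r: "limitin (lower_topology fuzzy_predicates) r m' F"
      using r_eq by (intro limitin_transform_eventually[OF _ lim]) (auto elim: eventually_mono)
    have "n b \<le> transport star \<phi> m' b" for b
    proof (rule transport_limit[OF assms F r lim_r])
      have "F \<noteq> bot" using F by (simp add: ultrafilter_def)
      then show "is_lub {y. eventually (\<lambda>_. y \<le> b) F} b" by (auto simp: is_lub_def)
      show "eventually (\<lambda>m. n b \<le> transport star \<phi> (r m) b) F"
        using S r_eq by eventually_elim (auto simp: le_fun_def)
    qed
    then show "m' \<in> ?S" using m' by (simp add: le_fun_def)
  qed auto
qed

theorem proposition2p5:
  fixes star :: "'l::complete_distrib_lattice \<Rightarrow> 'l \<Rightarrow> 'l"
    and \<phi> :: "'d::complete_continuous_semilattice \<Rightarrow> 'e::complete_continuous_semilattice \<Rightarrow> 'l"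
  assumes "unital_quantale star"
    and "inf_distributive star"
    and "range \<phi> \<subseteq> fuzzy_predicates"
    and "mono \<phi>"
  shows "(lower_continuous (fuzzy_predicates :: ('d \<Rightarrow> 'l) set)
            (fuzzy_predicates :: ('e \<Rightarrow> 'l) set) (strongest_post star \<phi>)
          \<longleftrightarrow> lower_continuous UNIV (fuzzy_predicates :: ('e \<Rightarrow> 'l) set) \<phi>)
       \<and> (lower_continuous UNIV (fuzzy_predicates :: ('e \<Rightarrow> 'l) set) \<phi>
          \<longrightarrow> (\<forall>m \<in> fuzzy_predicates. \<forall>b.
                 strongest_post star \<phi> m b = (SUP a. star (m a) (\<phi> a b))))"
proof -
  have formula: "strongest_post star \<phi> m = transport star \<phi> m"
    if "lower_continuous UNIV (fuzzy_predicates :: ('e \<Rightarrow> 'l) set) \<phi>" "m \<in> fuzzy_predicates" for m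
    using transport_in_fuzzy_predicates[OF assms(1-3) that] by (rule strongest_post_eq_transport)
  have "lower_continuous UNIV (fuzzy_predicates :: ('e \<Rightarrow> 'l) set) \<phi>"
    if "lower_continuous (fuzzy_predicates :: ('d \<Rightarrow> 'l) set)
          (fuzzy_predicates :: ('e \<Rightarrow> 'l) set) (strongest_post star \<phi>)"
  proof -
    have "\<phi> = strongest_post star \<phi> \<circ> (\<lambda>a. step_predicate a top)"
      using strongest_post_characteristic[OF assms(1,3,4)] by (simp add: fun_eq_iff)
    then show ?thesis
      using continuous_map_compose lower_continuous_characteristic that
      unfolding lower_continuous_def by metis
  qed
  moreover have "lower_continuous (fuzzy_predicates :: ('d \<Rightarrow> 'l) set)
      (fuzzy_predicates :: ('e \<Rightarrow> 'l) set) (strongest_post star \<phi>)"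
    if "lower_continuous UNIV (fuzzy_predicates :: ('e \<Rightarrow> 'l) set) \<phi>"
    using lower_continuous_transport[OF assms(1-3) that] formula[OF that]
    unfolding lower_continuous_def by (auto elim: continuous_map_eq)
  ultimately show ?thesis using formula by (auto simp: transport_def)
qed

end
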